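(* For every finite set $A\subset\mathbb{R}$, $$|A(A+A+A+A)|\gg \frac{|A|^2}{\log|A|},$$ where $A(A+A+A+A)=\{a(b+c+d+e): a,b,c,d,e\in A\}$.
   Context: $X\gg Y$ means $X\geq cY$ for some absolute constant $c>0$. Logarithms are to base 2. *)

theory Defs
  imports Complex_Main
begin

definition prod_fourfold_sum :: "real set \<Rightarrow> real set" where
  "prod_fourfold_sum A = {a * (b + c + d + e) | a b c d e.
      a \<in> A \<and> b \<in> A \<and> c \<in> A \<and> d \<in> A \<and> e \<in> A}"

end

theory Submission
  imports Defs "HOL-Analysis.Convex"
begin

text \<open>
  Replacing \<open>A\<close> by \<open>-A\<close> if necessary, one may pass to the positive elements of \<open>A\<close>. Put \<open>B = A + A\<close>.
  By Cauchy--Schwarz, \<open>|A(B + B)|\<close> is at least \<open>|A|^2 |B|^4\<close> divided by the number of solutions of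
  \<open>a(b + c) = a'(b' + c')\<close>. Grouped by the ratio \<open>x = a / a'\<close>, that number is the sum of \<open>r(x) q(x)\<close>, where
  \<open>r(x)\<close> counts pairs with ratio \<open>x\<close> and \<open>q(x)\<close> counts solutions of \<open>b' + c' = x(b + c)\<close> in \<open>B\<close>.
  Both factors satisfy a weak \<open>L^2\<close> bound: the minimum of \<open>r\<close> over a set \<open>Y\<close> of ratios is \<open>O(|B| / |Y|^(1/2))\<close>,
  since vector sums of points on consecutive lines through the origin lie in disjoint sectors (Solymosi);
  the minimum of \<open>q\<close> is \<open>O(|B|^3 / |Y|^(1/2))\<close>, which is a point-line incidence bound for a grid.
  Hence \<open>r\<close> and \<open>q\<close> have \<open>L^2\<close> norms \<open>O(|B| (log |A|)^(1/2))\<close> and \<open>O(|B|^3 (log |A|)^(1/2))\<close>, and the sum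
  is \<open>O(|B|^4 log |A|)\<close>.

  The incidence bound does not need the Szemeredi--Trotter theorem: cut the grid into cells of
  \<open>s \<times> s\<close> points with \<open>s\<close> about \<open>|Y|^(1/2)\<close>. A line of positive slope is monotone, so it meets \<open>O(|B| / s)\<close>
  cells, and by Cauchy--Schwarz it suffices to count aligned pairs inside a common cell, where
  distinct points span only one slope.
\<close>

section \<open>Cauchy-Schwarz for collisions of maps\<close>

lemma card_squared_le_collisions:
  fixes g :: "'a \<Rightarrow> 'b"
  assumes P: "finite P" and K: "finite K" and g: "g ` P \<subseteq> K"
  shows "(card P)\<^sup>2 \<le> card K * card {(p, q). p \<in> P \<and> q \<in> P \<and> g p = g q}"
proof -
  let ?F = "\<lambda>k. {p \<in> P. g p = k}"
  have *: "card P = (\<Sum>k\<in>K. card (?F k))"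
  proof -
    have "P = (\<Union>k\<in>K. ?F k)" using g by auto
    moreover have "card (\<Union>k\<in>K. ?F k) = (\<Sum>k\<in>K. card (?F k))"
      using P K by (intro card_UN_disjoint) auto
    ultimately show ?thesis by simp
  qed
  have **: "card {(p, q). p \<in> P \<and> q \<in> P \<and> g p = g q} = (\<Sum>k\<in>K. (card (?F k))\<^sup>2)"
  proof -
    have "{(p, q). p \<in> P \<and> q \<in> P \<and> g p = g q} = (\<Union>k\<in>K. ?F k \<times> ?F k)" using g by auto
    moreover have "card (\<Union>k\<in>K. ?F k \<times> ?F k) = (\<Sum>k\<in>K. card (?F k \<times> ?F k))"
      using P K by (intro card_UN_disjoint) auto
    ultimately show ?thesis by (simp add: power2_eq_square card_cartesian_product)
  qed
  have "(\<Sum>k\<in>K. real (card (?F k)))\<^sup>2 \<le> (\<Sum>k\<in>K. (real (card (?F k)))\<^sup>2) * real (card K)"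
    by (rule sum_squared_le_sum_of_squares)
  then have "real ((card P)\<^sup>2) \<le> real (card K * card {(p, q). p \<in> P \<and> q \<in> P \<and> g p = g q})"
    unfolding * ** by (simp add: mult.commute)
  then show ?thesis by (simp only: of_nat_le_iff)
qed

text \<open>Apply the previous lemma inside each fibre of \<open>h\<close> and add up. Below,
  \<open>h\<close> labels the line through a point and \<open>g\<close> separates the cells that the
  line meets.\<close>

lemma card_collisions_refine:
  fixes g :: "'a \<Rightarrow> 'b" and h :: "'a \<Rightarrow> 'c"
  assumes P: "finite P" and K: "finite K" and g: "g ` P \<subseteq> K"
  shows "card {(p, q). p \<in> P \<and> q \<in> P \<and> h p = h q}
    \<le> card K * card {(p, q). p \<in> P \<and> q \<in> P \<and> h p = h q \<and> g p = g q}"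
proof -
  let ?F = "\<lambda>t. {p \<in> P. h p = t}"
  let ?C = "\<lambda>t. {(p, q). p \<in> ?F t \<and> q \<in> ?F t \<and> g p = g q}"
  have fin: "finite (?C t)" for t
    by (rule finite_subset[of _ "P \<times> P"]) (use P in auto)
  have "{(p, q). p \<in> P \<and> q \<in> P \<and> h p = h q} = (\<Union>t\<in>h ` P. ?F t \<times> ?F t)" by auto
  moreover have "card (\<Union>t\<in>h ` P. ?F t \<times> ?F t) = (\<Sum>t\<in>h ` P. card (?F t \<times> ?F t))"
    using P by (intro card_UN_disjoint) auto
  ultimately have "card {(p, q). p \<in> P \<and> q \<in> P \<and> h p = h q} = (\<Sum>t\<in>h ` P. (card (?F t))\<^sup>2)"
    by (simp add: power2_eq_square card_cartesian_product)
  also have "\<dots> \<le> (\<Sum>t\<in>h ` P. card K * card (?C t))"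
    by (intro sum_mono card_squared_le_collisions) (use P K g in auto)
  also have "\<dots> = card K * card (\<Union>t\<in>h ` P. ?C t)"
  proof -
    have "card (\<Union>t\<in>h ` P. ?C t) = (\<Sum>t\<in>h ` P. card (?C t))"
      using P fin by (intro card_UN_disjoint) auto
    then show ?thesis by (simp add: sum_distrib_left)
  qed
  also have "(\<Union>t\<in>h ` P. ?C t) = {(p, q). p \<in> P \<and> q \<in> P \<and> h p = h q \<and> g p = g q}" by auto
  finally show ?thesis .
qed

section \<open>Incidences between lines and a grid\<close>

text \<open>The rank of \<open>d\<close>, counted from 0, is divided by \<open>s\<close>: in
  increasing order \<open>D\<close> is cut into runs of \<open>s\<close> consecutive elements, the
  last possibly shorter.\<close>

definition block :: "real set \<Rightarrow> nat \<Rightarrow> real \<Rightarrow> nat" where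
  "block D s d = card {e \<in> D. e < d} div s"

lemma block_mono: "finite D \<Longrightarrow> d \<le> d' \<Longrightarrow> block D s d \<le> block D s d'"
  unfolding block_def by (intro div_le_mono card_mono) auto

lemma block_le:
  assumes "finite D" "d \<in> D"
  shows "block D s d \<le> (card D - 1) div s"
proof -
  have "card {e \<in> D. e < d} \<le> card (D - {d})" using assms by (intro card_mono) auto
  then show ?thesis using assms unfolding block_def by (intro div_le_mono) simp
qed

text \<open>Rank is injective on \<open>D\<close>, and a block occupies an interval of
  \<open>s\<close> ranks, so each element shares its block with at most \<open>s\<close>
  elements.\<close>

lemma card_same_block_le:
  assumes D: "finite D" and s: "s > 0"
  shows "card {(d, d'). d \<in> D \<and> d' \<in> D \<and> block D s d = block D s d'} \<le> card D * s"
proof -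
  let ?rk = "\<lambda>d. card {e \<in> D. e < d}"
  have rk_less: "?rk d < ?rk d'" if "d \<in> D" "d < d'" for d d'
    using D that by (intro psubset_card_mono) auto
  have inj: "inj_on ?rk D"
    by (rule linorder_inj_onI') (rule less_imp_neq[OF rk_less])
  have fib: "card {d' \<in> D. block D s d = block D s d'} \<le> s" for d
  proof -
    let ?k = "block D s d"
    have "card {d' \<in> D. block D s d = block D s d'} = card (?rk ` {d' \<in> D. block D s d = block D s d'})"
      by (rule card_image[symmetric], rule inj_on_subset[OF inj]) auto
    also have "\<dots> \<le> card {?k * s..<?k * s + s}"
    proof (intro card_mono image_subsetI)
      fix d' assume "d' \<in> {d' \<in> D. block D s d = block D s d'}"
      then have "?k = ?rk d' div s" by (simp add: block_def)
      then have "?rk d' = ?k * s + ?rk d' mod s" using div_mult_mod_eq[of "?rk d'" s] by simp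
      moreover have "?rk d' mod s < s" using s by simp
      ultimately show "?rk d' \<in> {?k * s..<?k * s + s}"
        unfolding atLeastLessThan_iff by linarith
    qed simp
    finally show ?thesis by simp
  qed
  have "{(d, d'). d \<in> D \<and> d' \<in> D \<and> block D s d = block D s d'}
      = (SIGMA d:D. {d' \<in> D. block D s d = block D s d'})" by auto
  also have "card \<dots> = (\<Sum>d\<in>D. card {d' \<in> D. block D s d = block D s d'})"
    using D by (intro card_SigmaI) auto
  also have "\<dots> \<le> (\<Sum>d\<in>D. s)" by (intro sum_mono fib)
  finally show ?thesis by simp
qed

text \<open>Lines of slope \<open>x\<close> are labelled by their intercept. The cardinality is the
  sum over these lines of the squared number of grid points on them; diagonal pairs are
  included.\<close>

definition aligned_pairs :: "real set \<Rightarrow> real \<Rightarrow> ((real \<times> real) \<times> (real \<times> real)) set" where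
  "aligned_pairs D x =
    {(p, q). p \<in> D \<times> D \<and> q \<in> D \<times> D \<and> snd p - x * fst p = snd q - x * fst q}"

text \<open>The first factor bounds the cells met by one line, labelled by the sum of the two block
  indices. Inside cells, diagonal pairs give \<open>card X * (card D)\<^sup>2\<close>; the other
  pairs determine their slope, so over all of \<open>X\<close> they number at most
  \<open>(card D * s)\<^sup>2\<close>.\<close>

lemma sum_aligned_pairs_le_blocks:
  assumes D: "finite D" and s: "s > 0" and X: "finite X" "\<And>x. x \<in> X \<Longrightarrow> x > 0"
  shows "(\<Sum>x\<in>X. card (aligned_pairs D x))
    \<le> (2 * ((card D - 1) div s) + 1) * (card X * (card D)\<^sup>2 + (card D * s)\<^sup>2)"
proof -
  let ?K = "{..2 * ((card D - 1) div s)}"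
  let ?b = "block D s"
  let ?g = "\<lambda>p. ?b (fst p) + ?b (snd p)"
  let ?S = "{(p, q). p \<in> D \<times> D \<and> q \<in> D \<times> D \<and> ?b (fst p) = ?b (fst q) \<and> ?b (snd p) = ?b (snd q)}"
  let ?N = "\<lambda>x. {(p, q) \<in> ?S. p \<noteq> q \<and> snd p - x * fst p = snd q - x * fst q}"
  let ?C = "\<lambda>x. {(p, q). p \<in> D \<times> D \<and> q \<in> D \<times> D \<and>
    snd p - x * fst p = snd q - x * fst q \<and> ?g p = ?g q}"
  have finS: "finite ?S"
    by (rule finite_subset[of _ "(D \<times> D) \<times> (D \<times> D)"]) (use D in auto)
  have finN: "finite (?N x)" for x by (rule finite_subset[OF _ finS]) auto
  have pairs: "card (aligned_pairs D x) \<le> card ?K * card (?C x)" for x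
    unfolding aligned_pairs_def
  proof (rule card_collisions_refine)
    show "?g ` (D \<times> D) \<subseteq> ?K"
      using block_le[OF D, of _ s] by (force simp: mult_2 intro: add_mono)
  qed (use D in auto)
  have C: "card (?C x) \<le> (card D)\<^sup>2 + card (?N x)" if "x \<in> X" for x
  proof -
    have x: "x > 0" using X that by auto
    have "?C x \<subseteq> (\<lambda>p. (p, p)) ` (D \<times> D) \<union> ?N x"
    proof
      fix z assume "z \<in> ?C x"
      then obtain p1 p2 q1 q2 where z: "z = ((p1, p2), (q1, q2))"
        and D': "p1 \<in> D" "p2 \<in> D" "q1 \<in> D" "q2 \<in> D"
        and line: "p2 - x * p1 = q2 - x * q1" and key: "?b p1 + ?b p2 = ?b q1 + ?b q2"
        by auto
      \<comment> \<open>both block indices are monotone along the line, so their sum determines the cell\<close>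
      have "p2 \<le> q2 \<longleftrightarrow> x * p1 \<le> x * q1" "q2 \<le> p2 \<longleftrightarrow> x * q1 \<le> x * p1" using line by linarith+
      then have "p2 \<le> q2 \<longleftrightarrow> p1 \<le> q1" "q2 \<le> p2 \<longleftrightarrow> q1 \<le> p1" using x by simp_all
      then have "(?b p1 \<le> ?b q1 \<and> ?b p2 \<le> ?b q2) \<or> (?b q1 \<le> ?b p1 \<and> ?b q2 \<le> ?b p2)"
        using block_mono[OF D] by (meson linear)
      then have "?b p1 = ?b q1" "?b p2 = ?b q2" using key by linarith+
      then show "z \<in> (\<lambda>p. (p, p)) ` (D \<times> D) \<union> ?N x"
        using z D' line by auto
    qed
    then have "card (?C x) \<le> card ((\<lambda>p. (p, p)) ` (D \<times> D) \<union> ?N x)"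
      using D finN by (intro card_mono) auto
    also have "\<dots> \<le> card ((\<lambda>p. (p, p)) ` (D \<times> D)) + card (?N x)" by (rule card_Un_le)
    also have "card ((\<lambda>p. (p, p)) ` (D \<times> D)) \<le> card (D \<times> D)" using D by (intro card_image_le) auto
    finally show ?thesis by (simp add: card_cartesian_product power2_eq_square)
  qed
  have "(\<Sum>x\<in>X. card (?N x)) = card (\<Union>x\<in>X. ?N x)"
  proof (rule card_UN_disjoint[symmetric])
    show "\<forall>x\<in>X. \<forall>y\<in>X. x \<noteq> y \<longrightarrow> ?N x \<inter> ?N y = {}"
    proof (intro ballI impI)
      fix x y :: real assume "x \<noteq> y"
      show "?N x \<inter> ?N y = {}"
      proof (rule equals0I)
        fix z assume z: "z \<in> ?N x \<inter> ?N y"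
        obtain p1 p2 q1 q2 where z_eq: "z = ((p1, p2), (q1, q2))" by (metis surj_pair)
        have e: "p2 - x * p1 = q2 - x * q1" "p2 - y * p1 = q2 - y * q1" "(p1, p2) \<noteq> (q1, q2)"
          using z unfolding z_eq by auto
        have "(x - y) * (p1 - q1) = 0" using e(1,2) by (simp add: algebra_simps)
        then have "p1 = q1" using \<open>x \<noteq> y\<close> by simp
        then show False using e by simp
      qed
    qed
  qed (use X finN in auto)
  also have "\<dots> \<le> card ?S" by (intro card_mono finS) auto
  also have "\<dots> \<le> (card D * s)\<^sup>2"
  proof -
    let ?T = "{(d, d'). d \<in> D \<and> d' \<in> D \<and> ?b d = ?b d'}"
    have "finite ?T" by (rule finite_subset[of _ "D \<times> D"]) (use D in auto)
    then have "card ?S \<le> card (?T \<times> ?T)"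
      \<comment> \<open>Regrouping by coordinate turns two points of one cell into two pairs within
        blocks, one pair per axis.\<close>
      by (intro card_inj_on_le[of "\<lambda>((p1, p2), (q1, q2)). ((p1, q1), (p2, q2))"]) (auto simp: inj_on_def)
    also have "\<dots> \<le> (card D * s) * (card D * s)"
      unfolding card_cartesian_product by (intro mult_le_mono card_same_block_le D s)
    finally show ?thesis by (simp add: power2_eq_square)
  qed
  finally have N: "(\<Sum>x\<in>X. card (?N x)) \<le> (card D * s)\<^sup>2" .
  have "(\<Sum>x\<in>X. card (aligned_pairs D x)) \<le> (\<Sum>x\<in>X. card ?K * ((card D)\<^sup>2 + card (?N x)))"
    by (intro sum_mono order_trans[OF pairs] mult_le_mono C order_refl)
  also have "\<dots> = card ?K * (card X * (card D)\<^sup>2 + (\<Sum>x\<in>X. card (?N x)))"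
    by (simp add: sum_distrib_left[symmetric] sum.distrib)
  also have "\<dots> \<le> card ?K * (card X * (card D)\<^sup>2 + (card D * s)\<^sup>2)"
    by (intro mult_le_mono add_mono N order_refl)
  finally show ?thesis by simp
qed

lemma sum_aligned_pairs_le:
  assumes D: "finite D" and X: "finite X" "X \<noteq> {}" "\<And>x. x \<in> X \<Longrightarrow> x > 0"
    and le: "card X \<le> (card D)\<^sup>2"
  shows "real (\<Sum>x\<in>X. card (aligned_pairs D x)) \<le> 12 * sqrt (card X) * real (card D) ^ 3"
proof -
  define n where "n = real (card D)"
  define w where "w = sqrt (real (card X))"
  \<comment> \<open>With \<open>s\<close> about \<open>sqrt (card X)\<close> the diagonal and
    off-diagonal terms are of equal order.\<close>
  define s where "s = nat \<lfloor>w\<rfloor>"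
  have "card X \<ge> 1" using X by (simp add: Suc_leI card_gt_0_iff)
  then have w1: "w \<ge> 1" unfolding w_def by simp
  have w2: "w\<^sup>2 = real (card X)" unfolding w_def by simp
  have n0: "n \<ge> 0" by (simp add: n_def)
  have "real (card X) \<le> n\<^sup>2" unfolding n_def using le by (simp flip: of_nat_power)
  then have wn: "w \<le> n" unfolding w_def using n0 by (simp add: real_le_lsqrt)
  have s_le: "real s \<le> w" and s_gt: "w < real s + 1" using w1 unfolding s_def by linarith+
  then have s1: "s \<ge> 1" using w1 by (cases s) auto
  then have ws: "w \<le> 2 * real s" using s_gt by linarith
  define m where "m = (card D - 1) div s"
  have "real m \<le> real (card D - 1) / real s" unfolding m_def by (rule of_nat_div_le_of_nat)
  also have "\<dots> \<le> n / real s" unfolding n_def by (intro divide_right_mono) auto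
  finally have "real m \<le> n / real s" .
  \<comment> \<open>Here \<open>card X \<le> (card D)\<^sup>2\<close> enters: since
    \<open>s \<le> w \<le> n\<close>, the \<open>+ 1\<close> is absorbed.\<close>
  moreover have "1 \<le> n / real s" using s1 s_le wn by (simp add: field_simps)
  ultimately have "2 * real m + 1 \<le> 3 * (n / real s)" by linarith
  also have "n / real s \<le> n / (w / 2)" using ws w1 s1 n0 by (intro divide_left_mono) auto
  finally have m_le: "2 * real m + 1 \<le> 6 * n / w" by simp
  have "(real s)\<^sup>2 \<le> w\<^sup>2" using s_le by (intro power_mono) auto
  then have "n\<^sup>2 * (real s)\<^sup>2 \<le> n\<^sup>2 * w\<^sup>2" by (intro mult_left_mono) auto
  then have pairs_le: "w\<^sup>2 * n\<^sup>2 + (n * real s)\<^sup>2 \<le> 2 * w\<^sup>2 * n\<^sup>2"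
    by (simp add: power_mult_distrib mult.commute)
  have "real (\<Sum>x\<in>X. card (aligned_pairs D x))
      \<le> real ((2 * m + 1) * (card X * (card D)\<^sup>2 + (card D * s)\<^sup>2))"
    unfolding m_def using s1 D X by (intro of_nat_mono sum_aligned_pairs_le_blocks) auto
  also have "\<dots> = (2 * real m + 1) * (w\<^sup>2 * n\<^sup>2 + (n * real s)\<^sup>2)"
    by (simp add: w2 n_def algebra_simps)
  also have "\<dots> \<le> (6 * n / w) * (2 * w\<^sup>2 * n\<^sup>2)"
    using n0 w1 by (intro mult_mono m_le pairs_le) auto
  also have "\<dots> = 12 * w * n ^ 3"
    using w1 by (simp add: power2_eq_square power3_eq_cube)
  finally show ?thesis unfolding w_def n_def .
qed

section \<open>Solymosi's sector argument\<close>

text \<open>Add the slopes in increasing order. For neighbouring slopes \<open>c < b\<close>, adding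
  a point on one line to a point on the other is injective, as the directions are independent, and
  the sums lie strictly between the lines. Thus each of the \<open>card Y - 1\<close> gaps gives
  \<open>t\<^sup>2\<close> new points of \<open>B \<times> B\<close>. Counting only points on or
  below the steepest line keeps the next sector disjoint from those already counted.\<close>

lemma solymosi_sectors:
  fixes A :: "real set"
  assumes A: "finite A" "\<And>a. a \<in> A \<Longrightarrow> a > 0" and Y: "finite Y" "Y \<noteq> {}"
    and t: "\<And>x. x \<in> Y \<Longrightarrow> t \<le> card {(a, a'). a \<in> A \<and> a' \<in> A \<and> a' = x * a}"
  defines "B \<equiv> {a + b | a b. a \<in> A \<and> b \<in> A}"
  shows "(card Y - 1) * t\<^sup>2 \<le> card {(u, v). u \<in> B \<and> v \<in> B \<and> v \<le> Max Y * u}"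
  using Y t
proof (induction Y rule: finite_linorder_max_induct)
  case empty
  then show ?case by simp
next
  case (insert b Y)
  let ?T = "\<lambda>m. {(u, v). u \<in> B \<and> v \<in> B \<and> v \<le> m * u}"
  let ?l = "\<lambda>x. {(a, a'). a \<in> A \<and> a' \<in> A \<and> a' = x * a}"
  show ?case
  proof (cases "Y = {}")
    case True
    then show ?thesis by simp
  next
    case False
    define c where "c = Max Y"
    have c: "c \<in> Y" "c < b" using insert False by (auto simp: c_def)
    have "B = (\<lambda>(a, b). a + b) ` (A \<times> A)" unfolding B_def by auto
    then have finB: "finite B" using A by simp
    have finT: "finite (?T m)" for m by (rule finite_subset[of _ "B \<times> B"]) (use finB in auto)
    have Bpos: "u > 0" if "u \<in> B" for u using that A unfolding B_def by (auto intro: add_pos_pos)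
    have max: "Max (insert b Y) = b" using insert by (intro Max_eqI) auto
    let ?f = "\<lambda>(p, q). (fst p + fst q, snd p + snd q) :: real \<times> real"
    have "t * t \<le> card (?l c) * card (?l b)" using c insert.prems by (intro mult_le_mono) auto
    also have "\<dots> = card (?l c \<times> ?l b)" by (simp add: card_cartesian_product)
    also have "\<dots> \<le> card (?T b - ?T c)"
    proof (rule card_inj_on_le[of ?f])
      show "inj_on ?f (?l c \<times> ?l b)"
      proof (rule inj_onI)
        fix z z' assume "z \<in> ?l c \<times> ?l b" "z' \<in> ?l c \<times> ?l b" "?f z = ?f z'"
        then obtain p q p' q' where z: "z = ((p, c * p), (q, b * q))" "z' = ((p', c * p'), (q', b * q'))"
          and e: "p + q = p' + q'" "c * p + b * q = c * p' + b * q'" by auto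
        have "(b - c) * (q - q') = (c * p + b * q - (c * p' + b * q')) - c * ((p + q) - (p' + q'))"
          by (simp add: algebra_simps)
        also have "\<dots> = 0" using e by simp
        finally have "q = q'" using c by simp
        then show "z = z'" using z e by simp
      qed
      show "?f ` (?l c \<times> ?l b) \<subseteq> ?T b - ?T c"
      proof (intro image_subsetI)
        fix z assume "z \<in> ?l c \<times> ?l b"
        then obtain p q where z: "z = ((p, c * p), (q, b * q))"
          and m: "p \<in> A" "c * p \<in> A" "q \<in> A" "b * q \<in> A" by auto
        have "p > 0" "q > 0" using A m by auto
        then have "c * p < b * p" "c * q < b * q" using c by auto
        then have "c * p + b * q \<le> b * (p + q)" "\<not> c * p + b * q \<le> c * (p + q)"
          by (auto simp: algebra_simps)
        moreover have "p + q \<in> B" "c * p + b * q \<in> B" using m unfolding B_def by blast+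
        ultimately show "?f z \<in> ?T b - ?T c" using z by simp
      qed
    qed (use finT in auto)
    also have "\<dots> = card (?T b) - card (?T c)"
    proof (rule card_Diff_subset)
      show "?T c \<subseteq> ?T b"
        using Bpos c by (auto intro: order_trans mult_right_mono less_imp_le)
    qed (rule finT)
    finally have step: "t * t \<le> card (?T b) - card (?T c)" .
    have "(card Y - 1) * t\<^sup>2 \<le> card (?T c)" unfolding c_def using insert False by auto
    moreover have "card (?T c) \<le> card (?T b)"
      using Bpos c by (intro card_mono finT) (auto intro: order_trans mult_right_mono less_imp_le)
    ultimately have "(card Y - 1) * t\<^sup>2 + t\<^sup>2 \<le> card (?T b)" using step
      by (simp add: power2_eq_square)
    moreover have "card (insert b Y) - 1 = Suc (card Y - 1)"
      using insert False by (auto simp: card_gt_0_iff)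
    ultimately show ?thesis unfolding max by simp
  qed
qed

section \<open>Weak bounds for both counts and their passage to sums of squares\<close>

text \<open>The source of the logarithm. The hypothesis is inherited by subsets, so elements can be
  deleted one at a time, which leaves \<open>M\<close> times a harmonic number.\<close>

lemma sum_squares_le_of_weak_bound:
  fixes f :: "'a \<Rightarrow> real"
  assumes "finite X" "X \<noteq> {}" "\<And>Y. Y \<subseteq> X \<Longrightarrow> Y \<noteq> {} \<Longrightarrow> \<exists>y\<in>Y. (f y)\<^sup>2 * card Y \<le> M"
  shows "(\<Sum>x\<in>X. (f x)\<^sup>2) \<le> M * (1 + ln (card X))"
  using assms
proof (induction "card X" arbitrary: X)
  case 0
  then show ?case by simp
next
  case (Suc n)
  \<comment> \<open>removing \<open>y\<close> costs \<open>M / card X\<close>, a term of a harmonic sum\<close>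
  obtain y where y: "y \<in> X" "(f y)\<^sup>2 * card X \<le> M" using Suc.prems by blast
  have M: "M \<ge> 0" by (rule order_trans[OF _ y(2)]) simp
  show ?case
  proof (cases "n = 0")
    case True
    then have "X = {y}" using Suc.hyps y by (metis One_nat_def card_1_singletonE singletonD)
    then show ?thesis using y by simp
  next
    case False
    have cX: "card X = Suc n" using Suc by simp
    have card: "n = card (X - {y})" using Suc y by simp
    have ne: "X - {y} \<noteq> {}" using False card by (metis card.empty)
    have IH: "(\<Sum>x\<in>X - {y}. (f x)\<^sup>2) \<le> M * (1 + ln (card (X - {y})))"
      by (rule Suc.hyps(1)[OF card _ ne]) (use Suc.prems in auto)
    have "(f y)\<^sup>2 \<le> M * (1 / Suc n)" using y(2) by (simp add: cX field_simps)
    also have "\<dots> \<le> M * (ln (Suc n) - ln n)"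
    proof (rule mult_left_mono[OF _ M])
      \<comment> \<open>This is \<open>ln u \<le> u - 1\<close> at \<open>u = n / (n + 1)\<close>,
        which bounds the harmonic term by a telescoping difference.\<close>
      have "ln (real n / Suc n) \<le> real n / Suc n - 1" using False by (intro ln_le_minus_one) simp
      moreover have "ln (real n / Suc n) = ln n - ln (Suc n)" using False by (simp add: ln_div del: of_nat_Suc)
      moreover have "real n / Suc n - 1 = - (1 / Suc n)" by (simp add: field_simps)
      ultimately show "1 / real (Suc n) \<le> ln (Suc n) - ln n" by linarith
    qed
    finally have "(f y)\<^sup>2 \<le> M * (ln (Suc n) - ln n)" .
    moreover have "(\<Sum>x\<in>X. (f x)\<^sup>2) = (f y)\<^sup>2 + (\<Sum>x\<in>X - {y}. (f x)\<^sup>2)"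
      using Suc.prems y by (intro sum.remove) auto
    ultimately show ?thesis using IH card cX by (simp add: algebra_simps)
  qed
qed

lemma card_le_card_sumset:
  fixes A :: "real set"
  assumes A: "finite A"
  shows "card A \<le> card {a + b | a b. a \<in> A \<and> b \<in> A}"
proof (cases "A = {}")
  case False
  then obtain a\<^sub>0 where "a\<^sub>0 \<in> A" by blast
  have "{a + b | a b. a \<in> A \<and> b \<in> A} = (\<lambda>(a, b). a + b) ` (A \<times> A)" by auto
  then have "finite {a + b | a b. a \<in> A \<and> b \<in> A}" using A by simp
  moreover have "(+) a\<^sub>0 ` A \<subseteq> {a + b | a b. a \<in> A \<and> b \<in> A}" using \<open>a\<^sub>0 \<in> A\<close> by blast
  ultimately show ?thesis by (intro card_inj_on_le[of "(+) a\<^sub>0"]) auto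
qed simp

text \<open>The sectors account for \<open>card Y - 1\<close> copies of \<open>t\<^sup>2\<close>.
  The missing copy is covered by \<open>t \<le> card A \<le> card B\<close>, whence the factor
  2.\<close>

lemma solymosi_weak_bound:
  fixes A :: "real set"
  assumes A: "finite A" "\<And>a. a \<in> A \<Longrightarrow> a > 0" and Y: "finite Y" "Y \<noteq> {}"
    and t: "\<And>x. x \<in> Y \<Longrightarrow> t \<le> card {(a, a'). a \<in> A \<and> a' \<in> A \<and> a' = x * a}"
  shows "t\<^sup>2 * card Y \<le> 2 * (card {a + b | a b. a \<in> A \<and> b \<in> A})\<^sup>2"
proof -
  define B where "B = {a + b | a b. a \<in> A \<and> b \<in> A}"
  have "B = (\<lambda>(a, b). a + b) ` (A \<times> A)" unfolding B_def by auto
  then have finB: "finite B" using A by simp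
  have *: "(card Y - 1) * t\<^sup>2 \<le> (card B)\<^sup>2"
  proof -
    have "(card Y - 1) * t\<^sup>2 \<le> card {(u, v). u \<in> B \<and> v \<in> B \<and> v \<le> Max Y * u}"
      unfolding B_def by (rule solymosi_sectors[OF A Y t])
    also have "\<dots> \<le> card (B \<times> B)" using finB by (intro card_mono) auto
    finally show ?thesis by (simp add: card_cartesian_product power2_eq_square)
  qed
  have "t \<le> card B"
  proof -
    obtain x where "x \<in> Y" using Y by blast
    then have "t \<le> card {(a, a'). a \<in> A \<and> a' \<in> A \<and> a' = x * a}" by (rule t)
    also have "\<dots> \<le> card A"
      using A by (intro card_inj_on_le[of fst]) (auto simp: inj_on_def)
    also have "\<dots> \<le> card B" unfolding B_def by (rule card_le_card_sumset[OF A(1)])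
    finally show ?thesis .
  qed
  then have "t\<^sup>2 \<le> (card B)\<^sup>2" by (rule power_mono) simp
  then have "(card Y - 1) * t\<^sup>2 + t\<^sup>2 \<le> 2 * (card B)\<^sup>2" using * by linarith
  moreover have "card Y = Suc (card Y - 1)" using Y by (simp add: card_gt_0_iff)
  then have "t\<^sup>2 * card Y = (card Y - 1) * t\<^sup>2 + t\<^sup>2" by (metis add.commute mult.commute mult_Suc)
  ultimately show ?thesis unfolding B_def by simp
qed

lemma exists_le_average:
  fixes f :: "'a \<Rightarrow> nat"
  assumes "finite Y" "Y \<noteq> {}"
  shows "\<exists>y\<in>Y. f y * card Y \<le> sum f Y"
proof -
  obtain y where y: "y \<in> Y" "f y = Min (f ` Y)"
    using assms by (metis (no_types, lifting) Min_in finite_imageI image_iff image_is_empty)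
  have "of_nat (card Y) * f y \<le> sum f Y" using assms y by (intro sum_bounded_below) simp
  then show ?thesis using y by (metis mult.commute of_nat_id)
qed

text \<open>Some \<open>y\<close> does no worse than the average over \<open>Y\<close>, and the
  average is controlled by the incidence bound.\<close>

lemma weak_bound_sum_ratio:
  fixes B :: "real set"
  assumes B: "finite B" and Y: "finite Y" "Y \<noteq> {}" "\<And>x. x \<in> Y \<Longrightarrow> x > 0"
    and le: "card Y \<le> (card B)\<^sup>2"
  defines "Q \<equiv> \<lambda>x. {((b, c), (b', c')). b \<in> B \<and> c \<in> B \<and> b' \<in> B \<and> c' \<in> B \<and> b' + c' = x * (b + c)}"
  shows "\<exists>y\<in>Y. (real (card (Q y)))\<^sup>2 * card Y \<le> 9216 * real (card B) ^ 6"
proof -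
  \<comment> \<open>\<open>b' + c' = x * (b + c)\<close> says that \<open>(b, b')\<close> and \<open>(- c, - c')\<close> lie on a line of slope \<open>x\<close>\<close>
  define D where "D = B \<union> uminus ` B"
  have finD: "finite D" using B by (simp add: D_def)
  have D_le: "card D \<le> 2 * card B"
    unfolding D_def using card_Un_le[of B "uminus ` B"] card_image_le[OF B, of uminus] by linarith
  have D_ge: "card B \<le> card D" unfolding D_def using B by (intro card_mono) auto
  have fin: "finite (aligned_pairs D x)" for x
    by (rule finite_subset[of _ "(D \<times> D) \<times> (D \<times> D)"]) (use finD in \<open>auto simp: aligned_pairs_def\<close>)
  have Q: "card (Q x) \<le> card (aligned_pairs D x)" for x
  proof (rule card_inj_on_le[of "\<lambda>((b, c), (b', c')). ((b, b'), (- c, - c'))", OF _ _ fin])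
    show "(\<lambda>((b, c), (b', c')). ((b, b'), (- c, - c'))) ` Q x \<subseteq> aligned_pairs D x"
    proof (rule image_subsetI)
      fix z assume "z \<in> Q x"
      then obtain b c b' c' where z: "z = ((b, c), (b', c'))" and e: "b' + c' = x * (b + c)"
        and m: "b \<in> B" "c \<in> B" "b' \<in> B" "c' \<in> B"
        unfolding Q_def by blast
      have "b' - x * b = - c' - x * - c" using e by (simp add: algebra_simps)
      moreover have "b \<in> D" "b' \<in> D" "- c \<in> D" "- c' \<in> D" using m unfolding D_def by blast+
      ultimately show "(\<lambda>((b, c), (b', c')). ((b, b'), (- c, - c'))) z \<in> aligned_pairs D x"
        unfolding z aligned_pairs_def by simp
    qed
  qed (auto simp: inj_on_def)
  obtain y where y: "y \<in> Y" "card (Q y) * card Y \<le> (\<Sum>x\<in>Y. card (Q x))"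
    using exists_le_average[OF Y(1,2), of "\<lambda>x. card (Q x)"] by (elim bexE)
  have "card Y \<le> (card D)\<^sup>2" by (rule order_trans[OF le power_mono[OF D_ge]]) simp
  have "real (card (Q y) * card Y) \<le> real (\<Sum>x\<in>Y. card (aligned_pairs D x))"
    using order_trans[OF y(2) sum_mono[OF Q]] by (rule of_nat_mono)
  also have "\<dots> \<le> 12 * sqrt (card Y) * real (card D) ^ 3"
    by (rule sum_aligned_pairs_le) fact+
  also have "\<dots> \<le> 12 * sqrt (card Y) * (2 * real (card B)) ^ 3"
    using D_le by (intro mult_left_mono power_mono) auto
  \<comment> \<open>Squaring removes the root and leaves one surplus factor \<open>card Y\<close> to
    cancel; \<open>9216 = (12 * 2 ^ 3)\<^sup>2\<close>, where the 2 comes from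
    \<open>card D \<le> 2 * card B\<close>.\<close>
  finally have "(real (card (Q y)) * card Y)\<^sup>2 \<le> (12 * sqrt (card Y) * (2 * real (card B)) ^ 3)\<^sup>2"
    by (intro power_mono) auto
  also have "\<dots> = 9216 * real (card B) ^ 6 * card Y"
    by (simp add: power_mult_distrib flip: power_mult)
  finally have "((real (card (Q y)))\<^sup>2 * card Y) * card Y \<le> (9216 * real (card B) ^ 6) * card Y"
    by (simp add: power_mult_distrib power2_eq_square ac_simps)
  moreover have "real (card Y) > 0" using Y by (simp add: card_gt_0_iff)
  ultimately have "(real (card (Q y)))\<^sup>2 * card Y \<le> 9216 * real (card B) ^ 6"
    by (rule mult_right_le_imp_le)
  then show ?thesis using y by blast
qed

section \<open>The bound for positive sets\<close>

lemma finite_prod_fourfold_sum: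
  assumes "finite A"
  shows "finite (prod_fourfold_sum A)"
proof (rule finite_subset)
  show "prod_fourfold_sum A \<subseteq> (\<lambda>(a, b, c, d, e). a * (b + c + d + e)) ` (A \<times> A \<times> A \<times> A \<times> A)"
  proof
    fix z assume "z \<in> prod_fourfold_sum A"
    then obtain a b c d e where "z = a * (b + c + d + e)" "(a, b, c, d, e) \<in> A \<times> A \<times> A \<times> A \<times> A"
      unfolding prod_fourfold_sum_def by blast
    then show "z \<in> (\<lambda>(a, b, c, d, e). a * (b + c + d + e)) ` (A \<times> A \<times> A \<times> A \<times> A)"
      by (intro image_eqI[of _ _ "(a, b, c, d, e)"]) simp_all
  qed
qed (use assms in simp)

lemma prod_fourfold_sum_pos:
  assumes A: "finite A" "A \<noteq> {}" "\<And>a. a \<in> A \<Longrightarrow> a > 0"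
  shows "(real (card A))\<^sup>2 \<le> 136 * real (card (prod_fourfold_sum A)) * (1 + 2 * ln (card A))"
proof -
  define B where "B = {a + b | a b. a \<in> A \<and> b \<in> A}"
  define S where "S = prod_fourfold_sum A"
  define X where "X = (\<lambda>(a, a'). a / a') ` (A \<times> A)"
  define R where "R = (\<lambda>x. {(a, a'). a \<in> A \<and> a' \<in> A \<and> a' = x * a})"
  define Q where "Q = (\<lambda>x. {((b, c), (b', c')). b \<in> B \<and> c \<in> B \<and> b' \<in> B \<and> c' \<in> B \<and> b' + c' = x * (b + c)})"
  define L where "L = 1 + ln (card X)"
  define n where "n = real (card B)"
  have "B = (\<lambda>(a, b). a + b) ` (A \<times> A)" unfolding B_def by auto
  then have finB: "finite B" using A by simp
  have finS: "finite S" unfolding S_def using A(1) by (rule finite_prod_fourfold_sum)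
  have X: "finite X" "X \<noteq> {}" "\<And>x. x \<in> X \<Longrightarrow> x > 0"
    using A unfolding X_def by auto
  have cX: "card X \<le> (card A)\<^sup>2"
    unfolding X_def power2_eq_square card_cartesian_product[symmetric] using A by (intro card_image_le) auto
  have AB: "card A \<le> card B" unfolding B_def by (rule card_le_card_sumset[OF A(1)])
  have A0: "card A > 0" using A by (simp add: card_gt_0_iff)
  then have n0: "n > 0" using AB by (simp add: n_def)
  have finR: "finite (R x)" for x
    by (rule finite_subset[of _ "A \<times> A"]) (use A in \<open>auto simp: R_def\<close>)
  have finQ: "finite (Q x)" for x
    by (rule finite_subset[of _ "(B \<times> B) \<times> (B \<times> B)"]) (use finB in \<open>auto simp: Q_def\<close>)
  have RR: "(\<Sum>x\<in>X. (real (card (R x)))\<^sup>2) \<le> 2 * n\<^sup>2 * L"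
    unfolding L_def
  proof (rule sum_squares_le_of_weak_bound[OF X(1,2)])
    fix Y assume Y: "Y \<subseteq> X" "Y \<noteq> {}"
    then have finY: "finite Y" using X finite_subset by blast
    \<comment> \<open>A minimiser makes \<open>t = card (R y)\<close> a lower bound on all of
      \<open>Y\<close>.\<close>
    obtain y where y: "y \<in> Y" "card (R y) = Min ((\<lambda>x. card (R x)) ` Y)"
      using finY Y(2) by (metis (no_types, lifting) Min_in finite_imageI image_iff image_is_empty)
    have "(card (R y))\<^sup>2 * card Y \<le> 2 * (card B)\<^sup>2"
      unfolding B_def
    proof (rule solymosi_weak_bound[OF A(1,3) finY Y(2)])
      fix x assume "x \<in> Y"
      then have "card (R y) \<le> card (R x)" unfolding y(2) using finY by simp
      then show "card (R y) \<le> card {(a, a'). a \<in> A \<and> a' \<in> A \<and> a' = x * a}" by (simp add: R_def)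
    qed
    then have "real ((card (R y))\<^sup>2 * card Y) \<le> real (2 * (card B)\<^sup>2)" by (rule of_nat_mono)
    then show "\<exists>y\<in>Y. (real (card (R y)))\<^sup>2 * card Y \<le> 2 * n\<^sup>2"
      using y(1) by (auto simp: n_def)
  qed
  have QQ: "(\<Sum>x\<in>X. (real (card (Q x)))\<^sup>2) \<le> 9216 * n ^ 6 * L"
    unfolding L_def
  proof (rule sum_squares_le_of_weak_bound[OF X(1,2)])
    fix Y assume Y: "Y \<subseteq> X" "Y \<noteq> {}"
    then have finY: "finite Y" using X finite_subset by blast
    have "card Y \<le> card X" using Y X by (intro card_mono)
    also have "\<dots> \<le> (card B)\<^sup>2" by (rule order_trans[OF cX power_mono[OF AB]]) simp
    finally show "\<exists>y\<in>Y. (real (card (Q y)))\<^sup>2 * card Y \<le> 9216 * n ^ 6"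
      unfolding Q_def n_def using finB finY Y X(3) by (intro weak_bound_sum_ratio) auto
  qed
  have L0: "L \<ge> 0" using X by (simp add: L_def Suc_leI card_gt_0_iff)
  have "(\<Sum>x\<in>X. real (card (R x)) * real (card (Q x)))\<^sup>2
      \<le> (\<Sum>x\<in>X. (real (card (R x)))\<^sup>2) * (\<Sum>x\<in>X. (real (card (Q x)))\<^sup>2)"
    by (rule Cauchy_Schwarz_ineq_sum)
  also have "\<dots> \<le> (2 * n\<^sup>2 * L) * (9216 * n ^ 6 * L)"
    using L0 by (intro mult_mono RR QQ sum_nonneg) auto
  \<comment> \<open>136 is the square root of \<open>2 * 9216 = 18432\<close>, rounded up.\<close>
  also have "\<dots> \<le> (136 * n ^ 4 * L)\<^sup>2"
  proof -
    have "(2 * n\<^sup>2 * L) * (9216 * n ^ 6 * L) = 18432 * (n ^ 4 * L)\<^sup>2"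
      by algebra
    also have "\<dots> \<le> 136\<^sup>2 * (n ^ 4 * L)\<^sup>2" by (intro mult_right_mono) auto
    finally show ?thesis by (simp add: power_mult_distrib)
  qed
  finally have RQ: "(\<Sum>x\<in>X. real (card (R x)) * real (card (Q x))) \<le> 136 * n ^ 4 * L"
    by (rule power2_le_imp_le) (use L0 n0 in simp)
  let ?g = "\<lambda>(a, b, c). a * (b + c)"
  let ?P = "A \<times> B \<times> B"
  let ?E = "{(p, q). p \<in> ?P \<and> q \<in> ?P \<and> ?g p = ?g q}"
  \<comment> \<open>The ratio is \<open>x = a / a'\<close>, so \<open>a = x * a'\<close> and the
    pair in \<open>R x\<close> is \<open>(a', a)\<close>, in swapped order.\<close>
  let ?f = "\<lambda>((a', a), ((b, c), (b', c'))). ((a, b, c), (a', b', c'))"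
  have "?E \<subseteq> (\<Union>x\<in>X. ?f ` (R x \<times> Q x))"
  proof
    fix z assume "z \<in> ?E"
    then obtain a b c a' b' c' where z: "z = ((a, b, c), (a', b', c'))"
      and m: "a \<in> A" "a' \<in> A" "b \<in> B" "c \<in> B" "b' \<in> B" "c' \<in> B"
      and e: "a * (b + c) = a' * (b' + c')" by auto
    have "a' > 0" using A m by auto
    then have "b' + c' = (a / a') * (b + c)" "a = (a / a') * a'" using e by (simp_all add: field_simps)
    then have "((a', a), ((b, c), (b', c'))) \<in> R (a / a') \<times> Q (a / a')"
      using m by (simp add: R_def Q_def)
    moreover have "a / a' \<in> X" using m unfolding X_def by force
    ultimately show "z \<in> (\<Union>x\<in>X. ?f ` (R x \<times> Q x))" unfolding z by force
  qed
  then have "card ?E \<le> card (\<Union>x\<in>X. ?f ` (R x \<times> Q x))"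
    using X finR finQ by (intro card_mono) auto
  also have "\<dots> \<le> (\<Sum>x\<in>X. card (?f ` (R x \<times> Q x)))" using X by (intro card_UN_le)
  also have "\<dots> \<le> (\<Sum>x\<in>X. card (R x \<times> Q x))" using finR finQ by (intro sum_mono card_image_le) auto
  finally have "card ?E \<le> (\<Sum>x\<in>X. card (R x) * card (Q x))" by (simp add: card_cartesian_product)
  then have "real (card ?E) \<le> real (\<Sum>x\<in>X. card (R x) * card (Q x))" by (rule of_nat_mono)
  then have E: "real (card ?E) \<le> 136 * n ^ 4 * L" using RQ by simp
  have "(card ?P)\<^sup>2 \<le> card S * card ?E"
  proof (rule card_squared_le_collisions)
    have "a * (b + c) \<in> S" if "a \<in> A" "b \<in> B" "c \<in> B" for a b c
    proof -
      from that obtain b1 b2 c1 c2 where "b = b1 + b2" "c = c1 + c2" "b1 \<in> A" "b2 \<in> A" "c1 \<in> A" "c2 \<in> A"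
        unfolding B_def by blast
      moreover from this have "a * (b + c) = a * (b1 + b2 + c1 + c2)" by (simp add: add.assoc)
      ultimately show ?thesis
        using \<open>a \<in> A\<close> unfolding S_def prod_fourfold_sum_def by blast
    qed
    then show "?g ` ?P \<subseteq> S" by auto
  qed (use A finB finS in auto)
  then have "real ((card ?P)\<^sup>2) \<le> real (card S * card ?E)" by (rule of_nat_mono)
  then have "(real (card A) * n\<^sup>2)\<^sup>2 \<le> real (card S) * real (card ?E)"
    by (simp add: card_cartesian_product n_def power2_eq_square)
  also have "\<dots> \<le> real (card S) * (136 * n ^ 4 * L)" by (intro mult_left_mono E) auto
  \<comment> \<open>Both sides carry the fourth power of \<open>card B\<close>, so the size of the
    sumset drops out.\<close>
  finally have "(real (card A))\<^sup>2 * n ^ 4 \<le> (136 * real (card S) * L) * n ^ 4"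
    by (simp add: power_mult_distrib ac_simps flip: power_mult)
  then have "(real (card A))\<^sup>2 \<le> 136 * real (card S) * L"
    by (rule mult_right_le_imp_le) (use n0 in simp)
  also have "\<dots> \<le> 136 * real (card S) * (1 + 2 * ln (card A))"
  proof (intro mult_left_mono)
    \<comment> \<open>There are at most \<open>(card A)\<^sup>2\<close> ratios, which doubles the
      logarithm.\<close>
    have "card X > 0" using X by (simp add: card_gt_0_iff)
    have "real (card X) \<le> (real (card A))\<^sup>2" using cX by (simp flip: of_nat_power)
    then have "ln (real (card X)) \<le> ln ((real (card A))\<^sup>2)" using \<open>card X > 0\<close> by (intro ln_mono) auto
    also have "\<dots> = 2 * ln (real (card A))" using A0 by (simp add: ln_realpow)
    finally show "L \<le> 1 + 2 * ln (card A)" by (simp add: L_def)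
  qed auto
  finally show ?thesis by (simp add: S_def)
qed

section \<open>Reduction to positive elements\<close>

lemma prod_fourfold_sum_uminus: "prod_fourfold_sum (uminus ` A) = prod_fourfold_sum A"
proof -
  have *: "- a * (- b + - c + - d + - e) = a * (b + c + d + e)" for a b c d e :: real
    by (simp add: algebra_simps)
  show ?thesis
  proof (intro set_eqI iffI)
    fix z assume "z \<in> prod_fourfold_sum (uminus ` A)"
    then show "z \<in> prod_fourfold_sum A"
      unfolding prod_fourfold_sum_def using * by blast
  next
    fix z assume "z \<in> prod_fourfold_sum A"
    then obtain a b c d e where "a \<in> A" "b \<in> A" "c \<in> A" "d \<in> A" "e \<in> A" "z = a * (b + c + d + e)"
      unfolding prod_fourfold_sum_def by blast
    then show "z \<in> prod_fourfold_sum (uminus ` A)"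
      unfolding prod_fourfold_sum_def using *[of a b c d e, symmetric] by blast
  qed
qed

text \<open>\<open>6528 = 16 * 136 * 3\<close>: 16 from passing to a quarter of \<open>A\<close>,
  136 from the positive case, and 3 from \<open>1 + 2 * ln (card P) \<le> 3 * log 2 N\<close>, which
  uses \<open>N \<ge> 2\<close>.\<close>

lemma prod_fourfold_sum_large_pos_part:
  assumes A: "finite A" "card A \<ge> 2" and P: "P \<subseteq> A" "4 * card P \<ge> card A" "\<And>a. a \<in> P \<Longrightarrow> a > 0"
  shows "1 / 6528 * real (card A) ^ 2 / log 2 (card A) \<le> card (prod_fourfold_sum A)"
proof -
  define N where "N = real (card A)"
  have N: "N \<ge> 2" using A by (simp add: N_def)
  have finP: "finite P" using A P finite_subset by blast
  have P0: "card P > 0" using A P by linarith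
  then have Pne: "P \<noteq> {}" by auto
  have S: "card (prod_fourfold_sum P) \<le> card (prod_fourfold_sum A)"
  proof (rule card_mono)
    show "prod_fourfold_sum P \<subseteq> prod_fourfold_sum A"
      using P(1) unfolding prod_fourfold_sum_def by blast
    show "finite (prod_fourfold_sum A)" using A(1) by (rule finite_prod_fourfold_sum)
  qed
  have log1: "log 2 N \<ge> 1" using N by (simp add: le_log_iff)
  have "ln N = ln 2 * log 2 N" by (simp add: log_def)
  also have "\<dots> \<le> 1 * log 2 N" using log1 by (intro mult_right_mono) (auto simp: ln_2_less_1 less_imp_le)
  finally have lnN: "ln N \<le> log 2 N" by simp
  have "card P \<le> card A" using A P by (intro card_mono)
  then have "ln (real (card P)) \<le> ln N" using P0 by (simp add: N_def)
  then have L: "1 + 2 * ln (card P) \<le> 3 * log 2 N" using lnN log1 by linarith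
  have "N \<le> 4 * real (card P)" using P(2) unfolding N_def by linarith
  then have "N\<^sup>2 \<le> (4 * real (card P))\<^sup>2" using N by (intro power_mono) auto
  also have "\<dots> = 16 * (real (card P))\<^sup>2" by (simp add: power_mult_distrib)
  also have "\<dots> \<le> 16 * (136 * real (card (prod_fourfold_sum P)) * (1 + 2 * ln (card P)))"
    by (intro mult_left_mono prod_fourfold_sum_pos finP Pne P(3)) auto
  also have "\<dots> \<le> 16 * (136 * real (card (prod_fourfold_sum A)) * (3 * log 2 N))"
    using S L P0 by (intro mult_left_mono mult_mono) auto
  finally show ?thesis using log1 unfolding N_def[symmetric] by (simp add: field_simps)
qed

theorem theorem2p7:
  shows "\<exists>C>0. \<forall>A :: real set. finite A \<and> card A \<ge> 2 \<longrightarrow>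
           real (card (prod_fourfold_sum A)) \<ge> C * real (card A) ^ 2 / log 2 (real (card A))"
proof (intro exI[of _ "1 / 6528"] conjI allI impI)
  fix A :: "real set" assume "finite A \<and> card A \<ge> 2"
  then have A: "finite A" "card A \<ge> 2" by auto
  let ?P = "{a \<in> A. a > 0}" and ?N = "{a \<in> A. a < 0}"
  have "A \<subseteq> insert 0 (?P \<union> ?N)" by auto
  then have "card A \<le> card (insert 0 (?P \<union> ?N))" using A by (intro card_mono) auto
  also have "\<dots> \<le> Suc (card (?P \<union> ?N))" by (rule card_insert_le_m1) auto
  also have "\<dots> \<le> Suc (card ?P + card ?N)" using card_Un_le by simp
  \<comment> \<open>Zero costs one element, so the larger sign class has at least
    \<open>(card A - 1) / 2\<close> elements, and this is at least \<open>card A / 4\<close> because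
    \<open>card A \<ge> 2\<close>.\<close>
  finally have "card A \<le> 4 * card ?P \<or> card A \<le> 4 * card ?N" using A by linarith
  then show "1 / 6528 * real (card A) ^ 2 / log 2 (card A) \<le> card (prod_fourfold_sum A)"
  proof
    assume "card A \<le> 4 * card ?P"
    then show ?thesis using A by (intro prod_fourfold_sum_large_pos_part[of A ?P]) auto
  next
    assume le: "card A \<le> 4 * card ?N"
    have card: "card (uminus ` A) = card A" "card (uminus ` ?N) = card ?N"
      by (auto intro!: card_image inj_onI)
    have "1 / 6528 * real (card (uminus ` A)) ^ 2 / log 2 (card (uminus ` A))
        \<le> card (prod_fourfold_sum (uminus ` A))"
      using A le card by (intro prod_fourfold_sum_large_pos_part[of _ "uminus ` ?N"]) auto
    then show ?thesis unfolding card prod_fourfold_sum_uminus .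
  qed
qed simp

end
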